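(* Let $X\subset\mathbb{R}^n$ be a closed semialgebraic set, let $a\in X$ be a point that is not isolated in $X$, and let $K$ be a compact neighbourhood of $a$ in $X$. Then there exist constants $C,\alpha>0$ such that $$\mathrm{dist}_K(N(x),N(a))\ge C\, d\big(x,\{y\in X: N(a)\subset N(y)\}\big)^{\alpha},\qquad x\in K.$$
   Context: For a closed set $X\subset\mathbb{R}^n$, $m(x)=\{y\in X:\|y-x\|=d(x,X)\}$ is the set of points of $X$ closest to $x\in\mathbb{R}^n$ (Euclidean norm and distance), and for $a\in X$, $N(a)=\{x\in\mathbb{R}^n: a\in m(x)\}$, a non-empty closed set. For non-empty compact sets, $\mathrm{dist}_H(A,B)=\max\{\max_{x\in A}d(x,B),\max_{x\in B}d(x,A)\}$. The metric $\mathrm{dist}_K$ on non-empty closed subsets of $\mathbb{R}^n$ (here the subscript $K$ is part of the name of the metric and unrelated to the set $K$) is defined as follows. Identify $\mathbb{R}^n$ with $R=\mathbb{R}^n\times\{-1\}\subset\mathbb{R}^{n+1}$, let $\mathbb{S}^n$ be the unit sphere in $\mathbb{R}^{n+1}$ with the Euclidean metric restricted from $\mathbb{R}^{n+1}$, let $P=(0,\dots,0,1)$, let $s:\mathbb{S}^n\setminus\{P\}\to R$, $s(x)=\left(\frac{-2x_1}{x_{n+1}-1},\dots,\frac{-2x_n}{x_{n+1}-1},-1\right)$ be the stereographic projection and $h=s^{-1}$. Then $\mathrm{dist}_K(S,T)=\mathrm{dist}_H(h(S)\cup\{P\},h(T)\cup\{P\})$. *)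

theory Defs
  imports "HOL-Analysis.Analysis"
begin

definition basic_semialgebraic :: "(real ^ 'n) set \<Rightarrow> bool" where
  "basic_semialgebraic S \<longleftrightarrow>
     (\<exists>F G. finite F \<and> finite G \<and> (\<forall>f\<in>F \<union> G. real_polynomial_function f) \<and>
        S = {x. (\<forall>f\<in>F. f x = 0) \<and> (\<forall>g\<in>G. g x > 0)})"

definition semialgebraic :: "(real ^ 'n) set \<Rightarrow> bool" where
  "semialgebraic S \<longleftrightarrow> (\<exists>\<B>. finite \<B> \<and> (\<forall>B\<in>\<B>. basic_semialgebraic B) \<and> S = \<Union>\<B>)"

definition closest_pts :: "(real ^ 'n) set \<Rightarrow> real ^ 'n \<Rightarrow> (real ^ 'n) set" where
  "closest_pts X x = {y \<in> X. norm (y - x) = infdist x X}"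

definition normal_set :: "(real ^ 'n) set \<Rightarrow> real ^ 'n \<Rightarrow> (real ^ 'n) set" where
  "normal_set X a = {x. a \<in> closest_pts X x}"

text \<open>Meaningful for non-empty compact sets, where the suprema are attained maxima.\<close>

definition dist_H :: "'a::metric_space set \<Rightarrow> 'a set \<Rightarrow> real" where
  "dist_H A B = max (SUP x\<in>A. infdist x B) (SUP x\<in>B. infdist x A)"

text \<open>The space $\mathbb{R}^{n+1}$ is the product type, whose norm is the Euclidean one.\<close>

definition north_pole :: "(real ^ 'n) \<times> real" where
  "north_pole = (0, 1)"

definition stereo :: "(real ^ 'n) \<times> real \<Rightarrow> (real ^ 'n) \<times> real" where
  "stereo p = ((\<chi> i. -2 * (fst p $ i) / (snd p - 1)), -1)"

definition inv_stereo :: "(real ^ 'n) \<times> real \<Rightarrow> (real ^ 'n) \<times> real" where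
  "inv_stereo = inv_into (sphere 0 1 - {north_pole}) stereo"

definition dist_K :: "(real ^ 'n) set \<Rightarrow> (real ^ 'n) set \<Rightarrow> real" where
  "dist_K S T =
     dist_H (insert north_pole (inv_stereo ` (S \<times> {-1})))
            (insert north_pole (inv_stereo ` (T \<times> {-1})))"

text \<open>A compact neighbourhood of \<open>a\<close> in the subspace \<open>X\<close>; it need not be open in \<open>X\<close>.\<close>

definition compact_nbhd_in :: "'a::topological_space set \<Rightarrow> 'a \<Rightarrow> 'a set \<Rightarrow> bool" where
  "compact_nbhd_in X a K \<longleftrightarrow>
     compact K \<and> K \<subseteq> X \<and> (\<exists>U. openin (top_of_set X) U \<and> a \<in> U \<and> U \<subseteq> K)"

end

theory Submission
  imports Defs
begin

text \<open>
  A point \<open>a\<close> of \<open>X\<close> belongs to \<open>N(y)\<close> with \<open>y \<in> X\<close> only for \<open>y = a\<close>; hence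
  \<open>{y \<in> X. N(a) \<subseteq> N(y)}\<close> is just \<open>{a}\<close>. Moreover \<open>N(x)\<close> lies in the half-space of
  points at least as close to \<open>x\<close> as to \<open>a\<close>, so all its points are at distance at least
  \<open>\<parallel>x - a\<parallel> / 2\<close> from \<open>a \<in> N(a)\<close>. The chordal distance is
  \<open>4 \<parallel>z - a\<parallel> / sqrt ((\<parallel>z\<parallel>\<^sup>2 + 4) (\<parallel>a\<parallel>\<^sup>2 + 4))\<close>, which turns this into a bound that is
  linear in \<open>\<parallel>x - a\<parallel>\<close> on bounded sets; the exponent is 1.
\<close>

text \<open>This is the closed form of the inverse stereographic projection \<open>h\<close>, with
  \<open>z\<close> standing for the point \<open>(z, -1)\<close> of the plane.\<close>

definition chart :: "(real ^ 'n) \<Rightarrow> (real ^ 'n) \<times> real" where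
  "chart z = ((4 / ((norm z)\<^sup>2 + 4)) *\<^sub>R z, ((norm z)\<^sup>2 - 4) / ((norm z)\<^sup>2 + 4))"

lemma norm_sq_plus_4_pos: "(norm z)\<^sup>2 + 4 > (0::real)"
  by (rule add_nonneg_pos) auto

lemma chart_inner:
  "chart z \<bullet> chart w
     = (16 * (z \<bullet> w) + ((norm z)\<^sup>2 - 4) * ((norm w)\<^sup>2 - 4))
        / (((norm z)\<^sup>2 + 4) * ((norm w)\<^sup>2 + 4))"
  by (simp add: chart_def add_divide_distrib)

lemma chart_in_sphere: "chart z \<in> sphere 0 1"
proof -
  have "chart z \<bullet> chart z = (16 * (norm z)\<^sup>2 + ((norm z)\<^sup>2 - 4)\<^sup>2) / ((norm z)\<^sup>2 + 4)\<^sup>2"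
    unfolding chart_inner by (simp add: power2_norm_eq_inner[symmetric] power2_eq_square[of "_ + _"]
        power2_eq_square[of "_ - _"])
  also have "16 * (norm z)\<^sup>2 + ((norm z)\<^sup>2 - 4)\<^sup>2 = ((norm z)\<^sup>2 + 4)\<^sup>2"
    by algebra
  also have "((norm z)\<^sup>2 + 4)\<^sup>2 / ((norm z)\<^sup>2 + 4)\<^sup>2 = 1"
    using norm_sq_plus_4_pos[of z] by simp
  finally show ?thesis
    by (simp add: norm_eq_1)
qed

lemma one_minus_snd_chart: "1 - snd (chart z) = 8 / ((norm z)\<^sup>2 + 4)"
  using norm_sq_plus_4_pos[of z] by (simp add: chart_def field_simps)

lemma chart_neq_north_pole: "chart z \<noteq> north_pole"
proof
  assume "chart z = north_pole"
  then have "8 / ((norm z)\<^sup>2 + 4) = 0"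
    using one_minus_snd_chart[of z] by (simp add: north_pole_def)
  then show False
    using norm_sq_plus_4_pos[of z] by simp
qed

lemma stereo_eq: "stereo p = ((2 / (1 - snd p)) *\<^sub>R fst p, -1)"
proof -
  have "- (2 * fst p $ i / (snd p - 1)) = 2 * fst p $ i / (1 - snd p)" for i
    by (metis minus_diff_eq minus_divide_right)
  then show ?thesis
    by (simp add: stereo_def vec_eq_iff)
qed

lemma stereo_chart: "stereo (chart z) = (z, -1)"
  using norm_sq_plus_4_pos[of z]
  by (simp add: stereo_eq one_minus_snd_chart) (simp add: chart_def)

text \<open>\<open>chart\<close> is a left inverse of \<open>stereo\<close> off the pole, which is
  what makes \<open>stereo\<close> injective there.\<close>

lemma chart_stereo:
  assumes "p \<in> sphere 0 1 - {north_pole}"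
  shows "chart (fst (stereo p)) = p"
proof -
  obtain u v where p: "p = (u, v)" by fastforce
  have uv: "(norm u)\<^sup>2 + v\<^sup>2 = 1"
    using assms by (simp add: p norm_prod_def)
  \<comment> \<open>Height 1 on the sphere forces \<open>u = 0\<close>, so the point would be the
    pole.\<close>
  have "v \<noteq> 1"
    using assms uv by (auto simp: p north_pole_def)
  moreover have "v \<le> 1"
    using uv by (metis abs_le_square_iff abs_one abs_le_D1 le_add_same_cancel2 one_power2
        zero_le_power2)
  ultimately have v: "1 - v > 0" by simp
  define z where "z = (2 / (1 - v)) *\<^sub>R u"
  have "(norm z)\<^sup>2 = 4 * (norm u)\<^sup>2 / (1 - v)\<^sup>2"
    by (simp add: z_def power_mult_distrib power_divide)
  \<comment> \<open>Factoring the sphere equation cancels one of the two factors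
    \<open>1 - v\<close> in the denominator.\<close>
  also have "(norm u)\<^sup>2 = (1 - v) * (1 + v)"
    using uv by (simp add: algebra_simps power2_eq_square)
  finally have nz: "(norm z)\<^sup>2 = 4 * (1 + v) / (1 - v)"
    using v by (simp add: power2_eq_square)
  have "(norm z)\<^sup>2 + 4 = 8 / (1 - v)" "(norm z)\<^sup>2 - 4 = 8 * v / (1 - v)"
    using v unfolding nz by (simp_all add: field_simps)
  then have "chart z = p"
    using v unfolding chart_def p by (simp add: z_def)
  then show ?thesis
    by (simp add: stereo_eq p z_def)
qed

text \<open>By injectivity, \<open>inv_into\<close> has only one preimage to choose, and
  \<open>chart z\<close> is one.\<close>

lemma inv_stereo_eq_chart: "inv_stereo (z, -1) = chart z"
proof -
  have "inj_on stereo (sphere 0 1 - {north_pole :: (real ^ 'n) \<times> real})"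
  proof (rule inj_onI)
    fix p q :: "(real ^ 'n) \<times> real"
    assume "p \<in> sphere 0 1 - {north_pole}" "q \<in> sphere 0 1 - {north_pole}"
      and "stereo p = stereo q"
    then show "p = q" by (metis chart_stereo)
  qed
  then show ?thesis
    unfolding inv_stereo_def
    by (rule inv_into_f_eq) (use chart_in_sphere chart_neq_north_pole stereo_chart in auto)
qed

lemma dist_sphere_sq:
  fixes p q :: "'a::real_inner"
  assumes "p \<in> sphere 0 1" "q \<in> sphere 0 1"
  shows "(dist p q)\<^sup>2 = 2 - 2 * (p \<bullet> q)"
  using assms
  by (simp add: dist_norm norm_eq_1 power2_norm_eq_inner inner_diff inner_commute)

lemma dist_chart_sq:
  "(dist (chart z) (chart w))\<^sup>2 = 16 * (dist z w)\<^sup>2 / (((norm z)\<^sup>2 + 4) * ((norm w)\<^sup>2 + 4))"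
proof -
  have "(dist z w)\<^sup>2 = (norm z)\<^sup>2 + (norm w)\<^sup>2 - 2 * (z \<bullet> w)"
    by (simp add: dist_norm power2_norm_eq_inner inner_diff inner_commute)
  then show ?thesis
    using norm_sq_plus_4_pos[of z] norm_sq_plus_4_pos[of w]
    unfolding dist_sphere_sq[OF chart_in_sphere chart_in_sphere] chart_inner
    by (simp add: divide_simps) (simp add: algebra_simps)
qed

lemma dist_chart_north_pole_sq: "(dist (chart w) north_pole)\<^sup>2 = 16 / ((norm w)\<^sup>2 + 4)"
proof -
  have "(dist (chart w) north_pole)\<^sup>2 = 2 - 2 * (chart w \<bullet> north_pole)"
    by (rule dist_sphere_sq[OF chart_in_sphere]) (simp add: north_pole_def norm_prod_def)
  also have "\<dots> = 2 * (1 - snd (chart w))"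
    by (simp add: north_pole_def inner_prod_def)
  finally show ?thesis
    unfolding one_minus_snd_chart by simp
qed

text \<open>Serves to trade the square roots in the chordal distances for
  \<open>norm z + 2\<close>.\<close>

lemma norm_sq_plus_4_le: "(norm z)\<^sup>2 + 4 \<le> (norm z + 2)\<^sup>2"
  by (simp add: power2_sum)

lemma dist_chart_ge:
  "dist (chart z) (chart w) \<ge> 4 * dist z w / ((norm z + 2) * (norm w + 2))"
proof (rule power2_le_imp_le)
  have "((norm z)\<^sup>2 + 4) * ((norm w)\<^sup>2 + 4) \<le> (norm z + 2)\<^sup>2 * (norm w + 2)\<^sup>2"
    by (intro mult_mono norm_sq_plus_4_le) auto
  then show "(4 * dist z w / ((norm z + 2) * (norm w + 2)))\<^sup>2 \<le> (dist (chart z) (chart w))\<^sup>2"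
    unfolding dist_chart_sq
    using norm_sq_plus_4_pos[of z] norm_sq_plus_4_pos[of w]
    by (simp add: power_divide power_mult_distrib frac_le)
qed simp

lemma dist_chart_north_pole_ge: "dist (chart w) north_pole \<ge> 4 / (norm w + 2)"
proof (rule power2_le_imp_le)
  show "(4 / (norm w + 2))\<^sup>2 \<le> (dist (chart w) north_pole)\<^sup>2"
    unfolding dist_chart_north_pole_sq
    using norm_sq_plus_4_pos[of w] norm_sq_plus_4_le[of w]
    by (simp add: power_divide frac_le)
qed simp

lemma infdist_le_dist_H:
  assumes "bounded A" "B \<noteq> {}" "p \<in> A"
  shows "infdist p B \<le> dist_H B A"
proof -
  obtain b where b: "b \<in> B" using assms(2) by blast
  obtain e where e: "\<forall>y\<in>A. dist b y \<le> e"
    using bounded_any_center assms(1) by blast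
  \<comment> \<open>Without an upper bound the real \<open>SUP\<close> would be unspecified.\<close>
  have "bdd_above ((\<lambda>x. infdist x B) ` A)"
    using e b by (intro bdd_aboveI2[of _ _ e]) (metis infdist_le2 dist_commute)
  then have "infdist p B \<le> (SUP x\<in>A. infdist x B)"
    using assms(3) by (rule cSUP_upper2) simp
  then show ?thesis
    by (simp add: dist_H_def)
qed

text \<open>A single point of \<open>T\<close> bounds the one-sided distance from \<open>T\<close>
  to \<open>S\<close>. The pole is tested separately because it is adjoined to the image of
  \<open>S\<close>.\<close>

lemma dist_K_ge:
  assumes "w \<in> T" "c \<le> dist (chart w) north_pole"
    and "\<And>z. z \<in> S \<Longrightarrow> c \<le> dist (chart w) (chart z)"
  shows "c \<le> dist_K S T"
proof -
  have img: "inv_stereo ` (U \<times> {-1}) = chart ` U" for U :: "(real ^ 'a) set"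
    by (force simp: inv_stereo_eq_chart image_iff)
  have "bounded (insert north_pole (chart ` T))"
    by (rule bounded_subset[OF bounded_insert[THEN iffD2, OF bounded_sphere[of 0 1]]])
      (use chart_in_sphere in blast)
  then have "infdist (chart w) (insert north_pole (chart ` S)) \<le> dist_K S T"
    unfolding dist_K_def img by (rule infdist_le_dist_H) (use assms(1) in auto)
  moreover have "c \<le> infdist (chart w) (insert north_pole (chart ` S))"
    unfolding infdist_def using assms(2,3)
    by (simp del: image_insert) (rule cINF_greatest, auto)
  ultimately show ?thesis by simp
qed

lemma mem_normal_set_self: "a \<in> X \<Longrightarrow> a \<in> normal_set X a"
  by (simp add: normal_set_def closest_pts_def)

lemma mem_normal_setD:
  assumes "a \<in> X" "z \<in> normal_set X x"
  shows "dist z x \<le> dist z a"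
  using assms infdist_le[of a X z]
  by (auto simp: normal_set_def closest_pts_def dist_norm norm_minus_commute)

text \<open>Test the inclusion at \<open>a\<close> itself: \<open>a\<close> in \<open>N(y)\<close>
  gives \<open>dist a y \<le> dist a a = 0\<close>.\<close>

lemma normal_set_superset_eq:
  assumes "a \<in> X"
  shows "{y \<in> X. normal_set X a \<subseteq> normal_set X y} = {a}"
  using assms mem_normal_set_self[OF assms] mem_normal_setD[OF assms, of a] by auto

text \<open>Triangle inequality through \<open>z\<close>, whose distance to \<open>x\<close> is at
  most that to \<open>a\<close>.\<close>

lemma dist_normal_set_ge:
  assumes "a \<in> X" "z \<in> normal_set X x"
  shows "dist x a / 2 \<le> dist z a"
  using mem_normal_setD[OF assms] dist_triangle[of x a z] by (simp add: dist_commute)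

lemma dist_K_normal_set_ge:
  assumes "a \<in> X" "dist x a \<le> M"
  shows "2 / ((norm a + 2) * (norm a + 2 + M)) * dist x a
           \<le> dist_K (normal_set X x) (normal_set X a)"
proof -
  define A where "A = norm a + 2"
  have A: "A > 0" by (simp add: A_def add_nonneg_pos)
  have M: "M \<ge> 0" using assms(2) zero_le_dist[of x a] by linarith
  show ?thesis
  proof (rule dist_K_ge[OF mem_normal_set_self[OF assms(1)]])
    have "2 * dist x a \<le> 4 * (A + M)"
      using assms(2) A M unfolding distrib_left by linarith
    then have "2 / (A * (A + M)) * dist x a \<le> 4 / A"
      using A M by (simp add: divide_simps)
    then show "2 / ((norm a + 2) * (norm a + 2 + M)) * dist x a \<le> dist (chart a) north_pole"
      unfolding A_def using dist_chart_north_pole_ge[of a] by linarith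
  next
    fix z assume z: "z \<in> normal_set X x"
    define u where "u = dist z a"
    have u: "dist x a / 2 \<le> u" "u \<ge> 0"
      using dist_normal_set_ge[OF assms(1) z] by (simp_all add: u_def)
    have nz: "norm z + 2 \<le> A + u"
      using norm_triangle_sub[of z a] by (simp add: A_def u_def dist_norm)
    \<comment> \<open>Here \<open>u\<close> is unbounded, as \<open>N(x)\<close> may be. The bound
      \<open>dist x a \<le> M\<close> controls the term that dominates for large \<open>u\<close>,
      and \<open>dist x a \<le> 2 * u\<close> the one for small \<open>u\<close>; their sum clears
      the denominators of the next estimate.\<close>
    have "dist x a * u \<le> M * (2 * u)" "A * dist x a \<le> A * (2 * u)"
      using assms(2) u A M by (auto intro!: mult_mono)
    then have "2 * dist x a * (A + u) \<le> 4 * u * (A + M)"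
      by (simp add: algebra_simps)
    then have "2 * dist x a / (A + M) \<le> 4 * u / (A + u)"
      using A M u(2) by (simp add: divide_simps)
    also have "\<dots> \<le> 4 * u / (norm z + 2)"
      using nz u(2) add_nonneg_pos[OF norm_ge_zero[of z], of 2] by (intro frac_le) auto
    finally have "2 * dist x a / (A + M) / A \<le> 4 * u / (norm z + 2) / A"
      using A by (intro divide_right_mono) auto
    also have "\<dots> \<le> dist (chart z) (chart a)"
      using dist_chart_ge[of z a] by (simp add: A_def u_def)
    finally show "2 / ((norm a + 2) * (norm a + 2 + M)) * dist x a \<le> dist (chart a) (chart z)"
      by (simp add: A_def dist_commute mult.commute)
  qed
qed

theorem mainTheorem11:
  fixes X K :: "(real ^ 'n) set" and a :: "real ^ 'n"
  assumes "closed X"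
    and "semialgebraic X"
    and "a \<in> X"
    and "\<not> a isolated_in X"
    and "compact_nbhd_in X a K"
  shows "\<exists>C \<alpha>. C > 0 \<and> \<alpha> > 0 \<and>
           (\<forall>x\<in>K. dist_K (normal_set X x) (normal_set X a)
                \<ge> C * infdist x {y \<in> X. normal_set X a \<subseteq> normal_set X y} powr \<alpha>)"
proof -
  have "bounded K"
    using assms(5) by (simp add: compact_nbhd_in_def compact_imp_bounded)
  then obtain M where M: "\<forall>x\<in>K. dist a x \<le> M"
    using bounded_any_center by blast
  have "a \<in> K"
    using assms(5) by (auto simp: compact_nbhd_in_def)
  \<comment> \<open>Evaluating the bound at \<open>a\<close> gives the sign of \<open>M\<close>,
    hence a positive constant.\<close>
  then have "M \<ge> 0" using M by force
  then have "2 / ((norm a + 2) * (norm a + 2 + M)) > 0"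
    by (intro divide_pos_pos mult_pos_pos add_pos_nonneg add_nonneg_pos) auto
  \<comment> \<open>The distance to the singleton \<open>{a}\<close> is \<open>dist x a\<close>, and
    \<open>powr 1\<close> fixes non-negative reals.\<close>
  moreover have "2 / ((norm a + 2) * (norm a + 2 + M))
        * infdist x {y \<in> X. normal_set X a \<subseteq> normal_set X y} powr 1
      \<le> dist_K (normal_set X x) (normal_set X a)" if "x \<in> K" for x
    using dist_K_normal_set_ge[OF assms(3), of x M] M that
    by (simp add: normal_set_superset_eq[OF assms(3)] dist_commute)
  ultimately show ?thesis
    by (intro exI[of _ "2 / ((norm a + 2) * (norm a + 2 + M))"] exI[of _ 1]) auto
qed

end
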